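(* Let $\mathsf{k}$ be a field. For any $\Sigma$-term $\tau\colon m\to n$ in $\mathbb{S}$, we have $$\llbracket\tau\rrbracket=\mathrm{bit}(\tau)$$ as subsets of $(\mathsf{k}^m)^{\mathbb Z}\times(\mathsf{k}^n)^{\mathbb Z}$, where $\llbracket\tau\rrbracket$ is the denotational semantics of $\tau$ and $\mathrm{bit}(\tau)$ is the set of all biinfinite traces on $\tau$.
   Context: $\mathsf{k}$ is a field. Syntax. $\Sigma$ consists of generators $\mathrm{add}\colon2\to1$, $\mathrm{zero}\colon0\to1$, $\mathrm{copy}\colon1\to2$, $\mathrm{disc}\colon1\to0$, $\mathrm{delay}\colon1\to1$, $\mathrm{scal}_a\colon1\to1$ ($a\in \mathsf{k}$), and mirror images $\mathrm{add}^{op}\colon1\to2$, $\mathrm{zero}^{op}\colon1\to0$, $\mathrm{copy}^{op}\colon2\to1$, $\mathrm{disc}^{op}\colon0\to1$, $\mathrm{delay}^{op}\colon1\to1$, $\mathrm{scal}_a^{op}\colon1\to1$. $\Sigma$-terms are built from generators, $\mathrm{id}\colon1\to1$ and $\mathrm{tw}\colon2\to2$ by composition $;$ (diagrammatic order) and $\oplus$. $\mathbb{S}$ is the free prop on $\Sigma$ (terms modulo the laws of strict symmetric monoidal categories). Denotational semantics. $\llbracket-\rrbracket$ sends $\tau\colon m\to n$ to a subset of $(\mathsf{k}^m)^{\mathbb Z}\times(\mathsf{k}^n)^{\mathbb Z}$, with $;$ interpreted as relational composition, $\oplus$ as direct sum of relations, $\mathrm{id}$ as the identity relation, $\mathrm{tw}$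 as the swap, and - $\mathrm{add}\mapsto\{((w,v),w+v)\}$, $\mathrm{zero}\mapsto\{((),0)\}$, $\mathrm{copy}\mapsto\{(w,(w,w))\}$, $\mathrm{disc}\mapsto\{(w,())\}$, - $\mathrm{scal}_a\mapsto\{(w,a\cdot w)\}$, $\mathrm{delay}\mapsto\{(w,s\cdot w)\}$ where $(s\cdot w)(t)=w(t-1)$, with $w,v$ ranging over $\mathsf{k}^{\mathbb Z}$; mirror-image generators are sent to the opposite relations. Operational semantics. $\Sigma^*$ is obtained from $\Sigma$ by replacing $\mathrm{delay}$ by a family of registers $\mathrm{reg}_k\colon1\to1$ ($k\in \mathsf{k}$) and $\mathrm{delay}^{op}$ by a family $\mathrm{reg}_k^{op}\colon1\to1$ ($k\in \mathsf{k}$). Transitions $\tau\xrightarrow[\mathbf v]{\mathbf u}\tau'$ between $\Sigma^*$-terms of type $m\to n$, with upper label $\mathbf u\in \mathsf{k}^m$ and lower label $\mathbf v\in \mathsf{k}^n$, are generated by the following rules, for all $k,l,a\in \mathsf{k}$: - $\mathrm{copy}\xrightarrow[(k,k)]{k}\mathrm{copy}$; $\mathrm{disc}\xrightarrow[()]{k}\mathrm{disc}$; $\mathrm{add}\xrightarrow[k+l]{(k,l)}\mathrm{add}$; $\mathrm{zero}\xrightarrow[0]{()}\mathrm{zero}$; $\mathrm{scal}_a\xrightarrow[al]{l}\mathrm{scal}_a$; - $\mathrm{reg}_l\xrightarrow[l]{k}\mathrm{reg}_k$; - $\mathrm{id}\xrightarrow[k]{k}\mathrm{id}$; $\mathrm{tw}\xrightarrow[(l,k)]{(k,l)}\mathrm{tw}$;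 - rules for mirror-image generators are the same with upper and lower labels swapped (e.g. $\mathrm{reg}^{op}_l\xrightarrow[k]{l}\mathrm{reg}^{op}_k$); - if $\sigma\xrightarrow[\mathbf v]{\mathbf u}\sigma'$ and $\tau\xrightarrow[\mathbf w]{\mathbf v}\tau'$ then $\sigma;\tau\xrightarrow[\mathbf w]{\mathbf u}\sigma';\tau'$; if $\sigma\xrightarrow[\mathbf v_1]{\mathbf u_1}\sigma'$ and $\tau\xrightarrow[\mathbf v_2]{\mathbf u_2}\tau'$ then $\sigma\oplus\tau\xrightarrow[(\mathbf v_1,\mathbf v_2)]{(\mathbf u_1,\mathbf u_2)}\sigma'\oplus\tau'$. Fix an ordering of the $d$ delays (occurrences of $\mathrm{delay}$ and $\mathrm{delay}^{op}$) in $\tau$. A register assignment is a function $\sigma\colon\{1,\dots,d\}\to \mathsf{k}$, and $\tau_\sigma$ is the $\Sigma^*$-term obtained from $\tau$ by replacing the $i$th delay by the corresponding register in state $\sigma(i)$. A computation on $\tau$ initialised at $\sigma$ is an infinite sequence of transitions $\tau_\sigma\xrightarrow[\mathbf v_0]{\mathbf u_0}\tau_{\sigma_1}\xrightarrow[\mathbf v_1]{\mathbf u_1}\tau_{\sigma_2}\to\cdots$; its trace is the sequence $(\mathbf u_0,\mathbf v_0),(\mathbf u_1,\mathbf v_1),\dots$ in $\mathsf{k}^m\oplus \mathsf{k}^n$. A reverse computation is defined in the same way, but with the source and target terms of the register rules swapped (i.e. $\mathrm{reg}_k\xrightarrow[l]{k}\mathrm{reg}_l$ and $\mathrm{reg}^{op}_k\xrightarrow[k]{l}\mathrm{reg}^{op}_l$).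 A biinfinite trace on $\tau\colon m\to n$ is a sequence $w\in(\mathsf{k}^m)^{\mathbb Z}\oplus(\mathsf{k}^n)^{\mathbb Z}$ such that there exist a register assignment $\sigma$, a trace $\phi$ of a computation on $\tau$ initialised at $\sigma$, and a trace $\psi$ of a reverse computation on $\tau$ initialised at $\sigma$ (both indexed from $0$) with $w(t)=\phi(t)$ for $t\ge0$ and $w(t)=\psi(-(t+1))$ for $t<0$. $\mathrm{bit}(\tau)$ is the set of all biinfinite traces on $\tau$. *)

theory Defs
  imports Main
begin

(* The alphabets Sigma and Sigma-star share all symbols except the stateful one, so they are two
   instances of one type: Cell carries no data in Sigma and a register state in Sigma-star. *)
datatype ('k, 's) gen = Add | Zero | Copy | Disc | Scal 'k | Cell 's

(* Op g is the mirror image of the generator g. *)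
datatype ('k, 's) circ =
    Gen "('k, 's) gen"
  | Op "('k, 's) gen"
  | Wire
  | Twist
  | Seq "('k, 's) circ" "('k, 's) circ"  (infixl ";;" 60)
  | Par "('k, 's) circ" "('k, 's) circ"  (infixl "\<oplus>" 65)

type_synonym 'k sigma_term = "('k, unit) circ"
type_synonym 'k sigma_star_term = "('k, 'k) circ"

abbreviation Delay :: "('k, unit) gen" where "Delay \<equiv> Cell ()"
abbreviation Reg :: "'k \<Rightarrow> ('k, 'k) gen" where "Reg k \<equiv> Cell k"

fun gen_dom :: "('k, 's) gen \<Rightarrow> nat" where
  "gen_dom Add = 2"
| "gen_dom Zero = 0"
| "gen_dom Copy = 1"
| "gen_dom Disc = 1"
| "gen_dom (Scal a) = 1"
| "gen_dom (Cell s) = 1"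

fun gen_cod :: "('k, 's) gen \<Rightarrow> nat" where
  "gen_cod Add = 1"
| "gen_cod Zero = 1"
| "gen_cod Copy = 2"
| "gen_cod Disc = 0"
| "gen_cod (Scal a) = 1"
| "gen_cod (Cell s) = 1"

inductive has_type :: "('k, 's) circ \<Rightarrow> nat \<Rightarrow> nat \<Rightarrow> bool"  ("_ : _ \<rightarrow> _" [51, 51, 51] 50) where
  type_gen: "Gen g : gen_dom g \<rightarrow> gen_cod g"
| type_op: "Op g : gen_cod g \<rightarrow> gen_dom g"
| type_wire: "Wire : 1 \<rightarrow> 1"
| type_twist: "Twist : 2 \<rightarrow> 2"
| type_seq: "\<lbrakk>\<sigma> : l \<rightarrow> m; \<tau> : m \<rightarrow> n\<rbrakk> \<Longrightarrow> \<sigma> ;; \<tau> : l \<rightarrow> n"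
| type_par: "\<lbrakk>\<sigma> : m1 \<rightarrow> n1; \<tau> : m2 \<rightarrow> n2\<rbrakk> \<Longrightarrow> \<sigma> \<oplus> \<tau> : m1 + m2 \<rightarrow> n1 + n2"


section \<open>Denotational semantics\<close>

(* An element of k^m is a list of length m and direct sum is append; an element of (k^m)^Z is a
   function from int to such lists. *)
type_synonym 'k signal = "int \<Rightarrow> 'k list"

definition signals :: "nat \<Rightarrow> 'k signal set" where
  "signals m = {w. \<forall>t. length (w t) = m}"

definition shift :: "(int \<Rightarrow> 'k) \<Rightarrow> int \<Rightarrow> 'k" where
  "shift w t = w (t - 1)"

fun den_gen :: "('k::field, unit) gen \<Rightarrow> ('k signal \<times> 'k signal) set" where
  "den_gen Add = {(\<lambda>t. [w t, v t], \<lambda>t. [w t + v t]) | w v. True}"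
| "den_gen Zero = {(\<lambda>t. [], \<lambda>t. [0])}"
| "den_gen Copy = {(\<lambda>t. [w t], \<lambda>t. [w t, w t]) | w. True}"
| "den_gen Disc = {(\<lambda>t. [w t], \<lambda>t. []) | w. True}"
| "den_gen (Scal a) = {(\<lambda>t. [w t], \<lambda>t. [a * w t]) | w. True}"
| "den_gen Delay = {(\<lambda>t. [w t], \<lambda>t. [shift w t]) | w. True}"

fun den :: "'k::field sigma_term \<Rightarrow> ('k signal \<times> 'k signal) set"  ("\<lbrakk>_\<rbrakk>") where
  "\<lbrakk>Gen g\<rbrakk> = den_gen g"
| "\<lbrakk>Op g\<rbrakk> = (den_gen g)\<inverse>"
| "\<lbrakk>Wire\<rbrakk> = {(\<lambda>t. [w t], \<lambda>t. [w t]) | w. True}"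
| "\<lbrakk>Twist\<rbrakk> = {(\<lambda>t. [w t, v t], \<lambda>t. [v t, w t]) | w v. True}"
| "\<lbrakk>\<sigma> ;; \<tau>\<rbrakk> = \<lbrakk>\<sigma>\<rbrakk> O \<lbrakk>\<tau>\<rbrakk>"
| "\<lbrakk>\<sigma> \<oplus> \<tau>\<rbrakk> = {(\<lambda>t. u1 t @ u2 t, \<lambda>t. v1 t @ v2 t) | u1 v1 u2 v2.
      (u1, v1) \<in> \<lbrakk>\<sigma>\<rbrakk> \<and> (u2, v2) \<in> \<lbrakk>\<tau>\<rbrakk>}"


section \<open>Operational semantics\<close>

datatype direction = Forward | Reverse

(* Transitions of generators; the two directions differ only in the register rule, whose source
   and target are swapped. Arguments: source, upper label, lower label, target. *)
inductive gen_trans ::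
  "direction \<Rightarrow> ('k::field, 'k) gen \<Rightarrow> 'k list \<Rightarrow> 'k list \<Rightarrow> ('k, 'k) gen \<Rightarrow> bool"
  for d :: direction where
  tr_copy: "gen_trans d Copy [k] [k, k] Copy"
| tr_disc: "gen_trans d Disc [k] [] Disc"
| tr_add: "gen_trans d Add [k, l] [k + l] Add"
| tr_zero: "gen_trans d Zero [] [0] Zero"
| tr_scal: "gen_trans d (Scal a) [l] [a * l] (Scal a)"
| tr_reg: "d = Forward \<Longrightarrow> gen_trans d (Reg l) [k] [l] (Reg k)"
| tr_reg_reverse: "d = Reverse \<Longrightarrow> gen_trans d (Reg k) [k] [l] (Reg l)"

inductive transition ::
  "direction \<Rightarrow> 'k::field sigma_star_term \<Rightarrow> 'k list \<Rightarrow> 'k list \<Rightarrow> 'k sigma_star_term \<Rightarrow> bool"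
  for d :: direction where
  tr_gen: "gen_trans d g u v g' \<Longrightarrow> transition d (Gen g) u v (Gen g')"
| tr_op: "gen_trans d g u v g' \<Longrightarrow> transition d (Op g) v u (Op g')"
| tr_wire: "transition d Wire [k] [k] Wire"
| tr_twist: "transition d Twist [k, l] [l, k] Twist"
| tr_seq: "\<lbrakk>transition d \<sigma> u v \<sigma>'; transition d \<tau> v w \<tau>'\<rbrakk> \<Longrightarrow> transition d (\<sigma> ;; \<tau>) u w (\<sigma>' ;; \<tau>')"
| tr_par: "\<lbrakk>transition d \<sigma> u1 v1 \<sigma>'; transition d \<tau> u2 v2 \<tau>'\<rbrakk>
    \<Longrightarrow> transition d (\<sigma> \<oplus> \<tau>) (u1 @ u2) (v1 @ v2) (\<sigma>' \<oplus> \<tau>')"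

fun gen_delays :: "('k, unit) gen \<Rightarrow> nat" where
  "gen_delays Delay = 1"
| "gen_delays _ = 0"

fun delays :: "'k sigma_term \<Rightarrow> nat" where
  "delays (Gen g) = gen_delays g"
| "delays (Op g) = gen_delays g"
| "delays Wire = 0"
| "delays Twist = 0"
| "delays (\<sigma> ;; \<tau>) = delays \<sigma> + delays \<tau>"
| "delays (\<sigma> \<oplus> \<tau>) = delays \<sigma> + delays \<tau>"

fun gen_inst :: "('k, unit) gen \<Rightarrow> 'k list \<Rightarrow> ('k, 'k) gen" where
  "gen_inst Add s = Add"
| "gen_inst Zero s = Zero"
| "gen_inst Copy s = Copy"
| "gen_inst Disc s = Disc"
| "gen_inst (Scal a) s = Scal a"
| "gen_inst Delay s = Reg (hd s)"

(* A register assignment is a list of length delays \<tau>, the delays being ordered from left to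
   right as they occur in \<tau>. *)
fun inst :: "'k sigma_term \<Rightarrow> 'k list \<Rightarrow> 'k sigma_star_term" where
  "inst (Gen g) s = Gen (gen_inst g s)"
| "inst (Op g) s = Op (gen_inst g s)"
| "inst Wire s = Wire"
| "inst Twist s = Twist"
| "inst (\<sigma> ;; \<tau>) s = inst \<sigma> (take (delays \<sigma>) s) ;; inst \<tau> (drop (delays \<sigma>) s)"
| "inst (\<sigma> \<oplus> \<tau>) s = inst \<sigma> (take (delays \<sigma>) s) \<oplus> inst \<tau> (drop (delays \<sigma>) s)"

definition register_assignment :: "'k sigma_term \<Rightarrow> 'k list \<Rightarrow> bool" where
  "register_assignment \<tau> s \<longleftrightarrow> length s = delays \<tau>"

(* phi is the trace of a computation (d = Forward) or of a reverse computation (d = Reverse) on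
   \<tau> initialised at s; S lists the successive register assignments. *)
definition is_trace ::
  "direction \<Rightarrow> 'k::field sigma_term \<Rightarrow> 'k list \<Rightarrow> (nat \<Rightarrow> 'k list \<times> 'k list) \<Rightarrow> bool" where
  "is_trace d \<tau> s \<phi> \<longleftrightarrow>
    (\<exists>S. S 0 = s \<and> (\<forall>i. register_assignment \<tau> (S i)) \<and>
      (\<forall>i. transition d (inst \<tau> (S i)) (fst (\<phi> i)) (snd (\<phi> i)) (inst \<tau> (S (Suc i)))))"

definition biinfinite_traces ::
  "nat \<Rightarrow> nat \<Rightarrow> 'k::field sigma_term \<Rightarrow> ('k signal \<times> 'k signal) set" where
  "biinfinite_traces m n \<tau> = {(u, v) \<in> signals m \<times> signals n.
      \<exists>s \<phi> \<psi>. register_assignment \<tau> s \<and>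
        is_trace Forward \<tau> s \<phi> \<and> is_trace Reverse \<tau> s \<psi> \<and>
        (\<forall>t\<ge>0. (u t, v t) = \<phi> (nat t)) \<and>
        (\<forall>t<0. (u t, v t) = \<psi> (nat (- (t + 1))))}"

end

(* A computation glued to a reverse computation along their common initial state is a run of the
   term indexed by the integers, because a reverse transition is a forward transition with source
   and target exchanged. The relation between the labels of such runs is compositional, so it
   coincides with the denotational semantics by induction on the term; a register emitting its
   state at time t and storing its input for time t + 1 is the shift. *)
theory Submission
  imports Defs
begin

section \<open>Runs indexed by the integers\<close>

text \<open>\<open>R t\<close> is the register assignment held just before the step at time
  \<open>t\<close>, which leads to \<open>R (t + 1)\<close>. With all integers as times there is no
  initial state, so a run is a condition on each time step separately.\<close>

definition run ::
  "'k::field sigma_term \<Rightarrow> (int \<Rightarrow> 'k list) \<Rightarrow> 'k signal \<Rightarrow> 'k signal \<Rightarrow> bool" where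
  "run \<tau> R u v \<longleftrightarrow> (\<forall>t. register_assignment \<tau> (R t) \<and>
      transition Forward (inst \<tau> (R t)) (u t) (v t) (inst \<tau> (R (t + 1))))"

text \<open>Transitions of \<open>Gen g\<close> and \<open>Op g\<close> both reduce to
  \<open>gen_trans\<close> for \<open>g\<close>, with labels exchanged for \<open>Op g\<close>; one
  analysis at this level serves both.\<close>

definition gen_run ::
  "('k::field, unit) gen \<Rightarrow> (int \<Rightarrow> 'k list) \<Rightarrow> 'k signal \<Rightarrow> 'k signal \<Rightarrow> bool" where
  "gen_run g R u v \<longleftrightarrow> (\<forall>t. length (R t) = gen_delays g \<and>
      gen_trans Forward (gen_inst g (R t)) (u t) (v t) (gen_inst g (R (t + 1))))"

inductive_simps gen_trans_Add_iff: "gen_trans d Add u v g"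
inductive_simps gen_trans_Zero_iff: "gen_trans d Zero u v g"
inductive_simps gen_trans_Copy_iff: "gen_trans d Copy u v g"
inductive_simps gen_trans_Disc_iff: "gen_trans d Disc u v g"
inductive_simps gen_trans_Scal_iff: "gen_trans d (Scal a) u v g"
inductive_simps gen_trans_Cell_iff: "gen_trans d (Cell s) u v g"

inductive_simps transition_Gen_iff: "transition d (Gen g) u v (Gen g')"
inductive_simps transition_Op_iff: "transition d (Op g) u v (Op g')"
inductive_simps transition_Wire_iff: "transition d Wire u v \<tau>"
inductive_simps transition_Twist_iff: "transition d Twist u v \<tau>"
inductive_simps transition_Seq_iff: "transition d (\<sigma> ;; \<tau>) u v (\<sigma>' ;; \<tau>')"
inductive_simps transition_Par_iff: "transition d (\<sigma> \<oplus> \<tau>) u v (\<sigma>' \<oplus> \<tau>')"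

section \<open>Time reversal of transitions\<close>

text \<open>Every rule but the register rule keeps the generator fixed, and exchanging source and
  target turns \<open>tr_reg\<close> into \<open>tr_reg_reverse\<close> with the labels
  unchanged.\<close>

lemma gen_trans_Forward_imp_Reverse:
  "gen_trans Forward g u v g' \<Longrightarrow> gen_trans Reverse g' u v g"
  by (cases rule: gen_trans.cases) (auto intro: gen_trans.intros)

lemma gen_trans_Reverse_imp_Forward:
  "gen_trans Reverse g u v g' \<Longrightarrow> gen_trans Forward g' u v g"
  by (cases rule: gen_trans.cases) (auto intro: gen_trans.intros)

lemma transition_Forward_imp_Reverse:
  "transition Forward \<sigma> u v \<tau> \<Longrightarrow> transition Reverse \<tau> u v \<sigma>"
  by (induction rule: transition.induct)
    (auto intro: transition.intros gen_trans_Forward_imp_Reverse)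

lemma transition_Reverse_imp_Forward:
  "transition Reverse \<sigma> u v \<tau> \<Longrightarrow> transition Forward \<tau> u v \<sigma>"
  by (induction rule: transition.induct)
    (auto intro: transition.intros gen_trans_Reverse_imp_Forward)

lemma transition_Reverse_iff:
  "transition Reverse \<sigma> u v \<tau> \<longleftrightarrow> transition Forward \<tau> u v \<sigma>"
  using transition_Forward_imp_Reverse transition_Reverse_imp_Forward by blast

section \<open>Runs compute the denotational semantics\<close>

lemma in_den_gen_iff: "(u, v) \<in> den_gen g \<longleftrightarrow> (\<exists>R. gen_run g R u v)"
proof (cases g)
  case Add
  \<comment> \<open>For a stateless generator, passing from labels at each time to signals is the
    axiom of choice. There are no delays, so the empty list is the only register assignment.\<close>
  have "(\<forall>t. \<exists>k l. u t = [k, l] \<and> v t = [k + l]) \<longleftrightarrow>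
      (\<exists>w z. \<forall>t. u t = [w t, z t] \<and> v t = [w t + z t])"
    by metis
  then show ?thesis
    using Add by (auto simp: gen_run_def gen_trans_Add_iff fun_eq_iff intro!: exI[of _ "\<lambda>_. []"])
next
  case Zero
  then show ?thesis
    by (auto simp: gen_run_def gen_trans_Zero_iff fun_eq_iff intro!: exI[of _ "\<lambda>_. []"])
next
  case Copy
  have "(\<forall>t. \<exists>k. u t = [k] \<and> v t = [k, k]) \<longleftrightarrow>
      (\<exists>w. \<forall>t. u t = [w t] \<and> v t = [w t, w t])"
    by metis
  then show ?thesis
    using Copy by (auto simp: gen_run_def gen_trans_Copy_iff fun_eq_iff intro!: exI[of _ "\<lambda>_. []"])
next
  case Disc
  have "(\<forall>t. \<exists>k. u t = [k] \<and> v t = []) \<longleftrightarrow> (\<exists>w. \<forall>t. u t = [w t] \<and> v t = [])"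
    by metis
  then show ?thesis
    using Disc by (auto simp: gen_run_def gen_trans_Disc_iff fun_eq_iff intro!: exI[of _ "\<lambda>_. []"])
next
  case (Scal a)
  have "(\<forall>t. \<exists>k. u t = [k] \<and> v t = [a * k]) \<longleftrightarrow>
      (\<exists>w. \<forall>t. u t = [w t] \<and> v t = [a * w t])"
    by metis
  then show ?thesis
    using Scal by (auto simp: gen_run_def gen_trans_Scal_iff fun_eq_iff intro!: exI[of _ "\<lambda>_. []"])
next
  case (Cell s)
  have "(u, v) \<in> den_gen Delay \<longleftrightarrow> (\<exists>w. \<forall>t. u t = [w t] \<and> v t = [w (t - 1)])"
    by (auto simp: fun_eq_iff shift_def)
  also have "\<dots> \<longleftrightarrow> (\<exists>R. gen_run Delay R u v)"
  proof
    assume "\<exists>w. \<forall>t. u t = [w t] \<and> v t = [w (t - 1)]"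
    then obtain w where "\<forall>t. u t = [w t] \<and> v t = [w (t - 1)]" ..
    \<comment> \<open>The state is forced: the register emits it as the lower label, so at time
      \<open>t\<close> it is the previous input \<open>w (t - 1)\<close>.\<close>
    then have "gen_run Delay (\<lambda>t. [w (t - 1)]) u v"
      by (simp add: gen_run_def gen_trans_Cell_iff)
    then show "\<exists>R. gen_run Delay R u v"
      by blast
  next
    assume "\<exists>R. gen_run Delay R u v"
    then obtain R where "gen_run Delay R u v" ..
    \<comment> \<open>The input at \<open>t\<close> is the state at \<open>t + 1\<close>, which
      suggests the signal \<open>\<lambda>t. hd (R (t + 1))\<close>. Writing \<open>t\<close> as
      \<open>t - 1 + 1\<close> in the output makes it literally that signal at
      \<open>t - 1\<close>.\<close>
    then have "\<forall>t. u t = [hd (R (t + 1))] \<and> v t = [hd (R (t - 1 + 1))]"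
      by (auto simp: gen_run_def gen_trans_Cell_iff)
    then show "\<exists>w. \<forall>t. u t = [w t] \<and> v t = [w (t - 1)]"
      by (intro exI[of _ "\<lambda>t. hd (R (t + 1))"])
  qed
  finally show ?thesis
    using Cell by simp
qed

text \<open>The state list of the composite splits after \<open>delays \<sigma>\<close> entries,
  just as \<open>inst\<close> distributes it.\<close>

lemma run_Seq_iff:
  "(\<exists>R. run (\<sigma> ;; \<tau>) R u w) \<longleftrightarrow> (\<exists>v. (\<exists>R. run \<sigma> R u v) \<and> (\<exists>R. run \<tau> R v w))"
proof
  assume "\<exists>R. run (\<sigma> ;; \<tau>) R u w"
  then obtain R where R: "run (\<sigma> ;; \<tau>) R u w" ..
  then have "\<forall>t. \<exists>v. transition Forward (inst \<sigma> (take (delays \<sigma>) (R t))) (u t) v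
        (inst \<sigma> (take (delays \<sigma>) (R (t + 1)))) \<and>
      transition Forward (inst \<tau> (drop (delays \<sigma>) (R t))) v (w t)
        (inst \<tau> (drop (delays \<sigma>) (R (t + 1))))"
    by (simp add: run_def transition_Seq_iff)
  \<comment> \<open>The middle label exists separately at each time; choice assembles these labels
    into a signal.\<close>
  then obtain v where
    "\<forall>t. transition Forward (inst \<sigma> (take (delays \<sigma>) (R t))) (u t) (v t)
        (inst \<sigma> (take (delays \<sigma>) (R (t + 1)))) \<and>
      transition Forward (inst \<tau> (drop (delays \<sigma>) (R t))) (v t) (w t)
        (inst \<tau> (drop (delays \<sigma>) (R (t + 1))))"
    by metis
  with R have "run \<sigma> (\<lambda>t. take (delays \<sigma>) (R t)) u v" "run \<tau> (\<lambda>t. drop (delays \<sigma>) (R t)) v w"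
    by (auto simp: run_def register_assignment_def)
  then show "\<exists>v. (\<exists>R. run \<sigma> R u v) \<and> (\<exists>R. run \<tau> R v w)"
    by blast
next
  assume "\<exists>v. (\<exists>R. run \<sigma> R u v) \<and> (\<exists>R. run \<tau> R v w)"
  then obtain v R1 R2 where "run \<sigma> R1 u v" "run \<tau> R2 v w"
    by blast
  \<comment> \<open>Since \<open>R1 t\<close> has length \<open>delays \<sigma>\<close>,
    \<open>take\<close> and \<open>drop\<close> recover the two summands.\<close>
  then have "run (\<sigma> ;; \<tau>) (\<lambda>t. R1 t @ R2 t) u w"
    by (auto simp: run_def register_assignment_def intro: tr_seq)
  then show "\<exists>R. run (\<sigma> ;; \<tau>) R u w"
    by blast
qed

text \<open>States split as for \<open>;;\<close>. The cuts of \<open>u t\<close> and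
  \<open>v t\<close> come from the transition rule at each time, and choice gathers the pieces into
  four signals.\<close>

lemma run_Par_iff:
  "(\<exists>R. run (\<sigma> \<oplus> \<tau>) R u v) \<longleftrightarrow>
    (\<exists>u1 v1 u2 v2. u = (\<lambda>t. u1 t @ u2 t) \<and> v = (\<lambda>t. v1 t @ v2 t) \<and>
      (\<exists>R. run \<sigma> R u1 v1) \<and> (\<exists>R. run \<tau> R u2 v2))" (is "?L \<longleftrightarrow> ?R")
proof
  assume ?L
  then obtain R where R: "run (\<sigma> \<oplus> \<tau>) R u v" ..
  then have "\<forall>t. \<exists>u1 v1 u2 v2. u t = u1 @ u2 \<and> v t = v1 @ v2 \<and>
      transition Forward (inst \<sigma> (take (delays \<sigma>) (R t))) u1 v1
        (inst \<sigma> (take (delays \<sigma>) (R (t + 1)))) \<and>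
      transition Forward (inst \<tau> (drop (delays \<sigma>) (R t))) u2 v2
        (inst \<tau> (drop (delays \<sigma>) (R (t + 1))))"
    by (simp add: run_def transition_Par_iff) blast
  then obtain u1 v1 u2 v2 where
    *: "\<forall>t. u t = u1 t @ u2 t \<and> v t = v1 t @ v2 t \<and>
      transition Forward (inst \<sigma> (take (delays \<sigma>) (R t))) (u1 t) (v1 t)
        (inst \<sigma> (take (delays \<sigma>) (R (t + 1)))) \<and>
      transition Forward (inst \<tau> (drop (delays \<sigma>) (R t))) (u2 t) (v2 t)
        (inst \<tau> (drop (delays \<sigma>) (R (t + 1))))"
    by metis
  with R have "run \<sigma> (\<lambda>t. take (delays \<sigma>) (R t)) u1 v1" "run \<tau> (\<lambda>t. drop (delays \<sigma>) (R t)) u2 v2"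
    by (auto simp: run_def register_assignment_def)
  moreover have "u = (\<lambda>t. u1 t @ u2 t)" "v = (\<lambda>t. v1 t @ v2 t)"
    using * by (simp_all add: fun_eq_iff)
  ultimately show ?R
    by blast
next
  assume ?R
  then obtain u1 v1 u2 v2 R1 R2 where
    "u = (\<lambda>t. u1 t @ u2 t)" "v = (\<lambda>t. v1 t @ v2 t)" "run \<sigma> R1 u1 v1" "run \<tau> R2 u2 v2"
    by blast
  then have "run (\<sigma> \<oplus> \<tau>) (\<lambda>t. R1 t @ R2 t) u v"
    by (auto simp: run_def register_assignment_def intro: tr_par)
  then show ?L
    by blast
qed

text \<open>Structural induction; the signals are arbitrary because the hypotheses are applied to
  the middle signal of a \<open>;;\<close> and to the components of a
  \<open>\<oplus>\<close>.\<close>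

lemma in_den_iff_run: "(u, v) \<in> \<lbrakk>\<tau>\<rbrakk> \<longleftrightarrow> (\<exists>R. run \<tau> R u v)"
proof (induction \<tau> arbitrary: u v)
  case (Gen g)
  show ?case
    by (simp add: in_den_gen_iff run_def gen_run_def register_assignment_def transition_Gen_iff)
next
  case (Op g)
  show ?case
    by (simp add: in_den_gen_iff run_def gen_run_def register_assignment_def transition_Op_iff)
next
  case Wire
  have "(\<forall>t. \<exists>k. u t = [k] \<and> v t = [k]) \<longleftrightarrow> (\<exists>w. \<forall>t. u t = [w t] \<and> v t = [w t])"
    by metis
  then show ?case
    by (auto simp: run_def register_assignment_def transition_Wire_iff fun_eq_iff
        intro!: exI[of _ "\<lambda>_. []"])
next
  case Twist
  have "(\<forall>t. \<exists>k l. u t = [k, l] \<and> v t = [l, k]) \<longleftrightarrow>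
      (\<exists>w z. \<forall>t. u t = [w t, z t] \<and> v t = [z t, w t])"
    by metis
  then show ?case
    by (auto simp: run_def register_assignment_def transition_Twist_iff fun_eq_iff
        intro!: exI[of _ "\<lambda>_. []"])
next
  case (Seq \<sigma> \<tau>)
  then show ?case
    by (auto simp: run_Seq_iff relcomp_unfold)
next
  case (Par \<sigma> \<tau>)
  then show ?case
    by (simp add: run_Par_iff)
qed

lemma den_gen_subset_signals: "den_gen g \<subseteq> signals (gen_dom g) \<times> signals (gen_cod g)"
  by (cases g) (auto simp: signals_def)

text \<open>\<open>biinfinite_traces\<close> restricts to signals of the given widths by definition,
  while \<open>den\<close> does not mention widths; typing supplies them.\<close>

lemma den_subset_signals:
  assumes "\<tau> : m \<rightarrow> n"
  shows "\<lbrakk>\<tau>\<rbrakk> \<subseteq> signals m \<times> signals n"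
  using assms
proof (induction \<tau> m n rule: has_type.induct)
  case (type_gen g)
  then show ?case
    using den_gen_subset_signals by simp
next
  case (type_op g)
  then show ?case
    using den_gen_subset_signals[of g] by auto
next
  case (type_par \<sigma> m1 n1 \<tau> m2 n2)
  then show ?case
    by (fastforce simp: signals_def)
qed (auto simp: signals_def)

section \<open>Cutting and gluing runs at time 0\<close>

lemma run_iff_traces:
  "(\<exists>R. run \<tau> R u v) \<longleftrightarrow>
    (\<exists>s \<phi> \<psi>. register_assignment \<tau> s \<and> is_trace Forward \<tau> s \<phi> \<and> is_trace Reverse \<tau> s \<psi> \<and>
      (\<forall>t\<ge>0. (u t, v t) = \<phi> (nat t)) \<and> (\<forall>t<0. (u t, v t) = \<psi> (nat (- (t + 1)))))"
    (is "?L \<longleftrightarrow> ?R")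
proof
  assume ?L
  then obtain R where R: "run \<tau> R u v" ..
  then have reg: "register_assignment \<tau> (R t)" for t
    by (simp add: run_def)
  \<comment> \<open>The later time is a variable tied by an equation, so that the rule applies to
    whatever form the index takes below.\<close>
  have step: "transition Forward (inst \<tau> (R t)) (u t) (v t) (inst \<tau> (R t'))" if "t' = t + 1" for t t'
    using R that by (simp add: run_def)
  define \<phi> where "\<phi> i = (u (int i), v (int i))" for i
  define \<psi> where "\<psi> i = (u (- 1 - int i), v (- 1 - int i))" for i
  have "is_trace Forward \<tau> (R 0) \<phi>"
    unfolding is_trace_def \<phi>_def
    by (intro exI[of _ "\<lambda>i. R (int i)"]) (auto simp: reg intro: step)
  moreover have "is_trace Reverse \<tau> (R 0) \<psi>"
    \<comment> \<open>Reverse step \<open>i\<close> leads from \<open>R (- i)\<close> to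
      \<open>R (- i - 1)\<close>; read forwards it is the step of the run at time
      \<open>- 1 - i\<close>.\<close>
    unfolding is_trace_def \<psi>_def
    by (intro exI[of _ "\<lambda>i. R (- int i)"]) (auto simp: reg transition_Reverse_iff intro: step)
  moreover have "\<forall>t\<ge>0. (u t, v t) = \<phi> (nat t)" "\<forall>t<0. (u t, v t) = \<psi> (nat (- (t + 1)))"
    by (auto simp: \<phi>_def \<psi>_def)
  ultimately show ?R
    using reg by blast
next
  assume ?R
  then obtain s \<phi> \<psi> S S' where
    S: "S 0 = s" "\<And>i. register_assignment \<tau> (S i)"
      "\<And>i. transition Forward (inst \<tau> (S i)) (fst (\<phi> i)) (snd (\<phi> i)) (inst \<tau> (S (Suc i)))" and
    S': "S' 0 = s" "\<And>i. register_assignment \<tau> (S' i)"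
      "\<And>i. transition Forward (inst \<tau> (S' (Suc i))) (fst (\<psi> i)) (snd (\<psi> i)) (inst \<tau> (S' i))" and
    \<phi>: "\<forall>t\<ge>0. (u t, v t) = \<phi> (nat t)" and
    \<psi>: "\<forall>t<0. (u t, v t) = \<psi> (nat (- (t + 1)))"
    unfolding is_trace_def transition_Reverse_iff by blast
  \<comment> \<open>The two state sequences overlap only at time 0, where both equal
    \<open>s\<close>.\<close>
  define R where "R t = (if t \<ge> 0 then S (nat t) else S' (nat (- t)))" for t
  have "transition Forward (inst \<tau> (R t)) (u t) (v t) (inst \<tau> (R (t + 1)))" for t
  proof (cases "t \<ge> 0")
    case True
    then have "(u t, v t) = \<phi> (nat t)" "R t = S (nat t)" "R (t + 1) = S (Suc (nat t))"
      using \<phi> by (auto simp: R_def nat_add_distrib)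
    then show ?thesis
      using S(3)[of "nat t"] by (metis fst_conv snd_conv)
  next
    case False
    define i where "i = nat (- (t + 1))"
    have t: "t = - int (Suc i)"
      using False by (simp add: i_def)
    have "(u t, v t) = \<psi> i"
      using False \<psi> by (simp add: i_def)
    \<comment> \<open>For \<open>i = 0\<close> the target lies at time 0, where \<open>R\<close> is
      defined through \<open>S\<close>; here \<open>S 0 = S' 0\<close> is what glues the
      halves.\<close>
    moreover have "R t = S' (Suc i)" "R (t + 1) = S' i"
      using S(1) S'(1) by (simp_all add: R_def t nat_add_distrib)
    ultimately show ?thesis
      using S'(3)[of i] by (metis fst_conv snd_conv)
  qed
  then have "run \<tau> R u v"
    using S(2) S'(2) by (simp add: run_def R_def)
  then show ?L
    by blast
qed

theorem lemma5p2:
  fixes \<tau> :: "'k::field sigma_term" and m n :: nat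
  assumes "\<tau> : m \<rightarrow> n"
  shows "\<lbrakk>\<tau>\<rbrakk> = biinfinite_traces m n \<tau>"
proof -
  have "biinfinite_traces m n \<tau> = {(u, v) \<in> signals m \<times> signals n. \<exists>R. run \<tau> R u v}"
    unfolding biinfinite_traces_def run_iff_traces ..
  then show ?thesis
    using den_subset_signals[OF assms] by (auto simp: in_den_iff_run)
qed

end
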